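(* For every integer $n \ge 1$, the additive group $(\mathbb{R}^n,+)$ is natural.
   Context: A group $(G,* )$ is called natural if there exists a metric $d$ on the underlying set $G$ such that (i) every right translation $R_g: x \mapsto x*g$, $g \in G$, is an isometry of $(G,d)$, and (ii) whenever $(G,\circ)$ is any group structure on the same set $G$ all of whose right translations are isometries of $(G,d)$, then $(G,\circ)$ is isomorphic to $(G,* )$ as an abstract group. *)

theory Defs
  imports "HOL-Analysis.Analysis" "HOL-Algebra.Group"
begin

definition isometry_of :: "'a set \<Rightarrow> ('a \<Rightarrow> 'a \<Rightarrow> real) \<Rightarrow> ('a \<Rightarrow> 'a) \<Rightarrow> bool" where
  "isometry_of M d f \<longleftrightarrow>
     bij_betw f M M \<and> (\<forall>x\<in>M. \<forall>y\<in>M. d (f x) (f y) = d x y)"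

definition right_translations_isometric ::
    "('a, 'b) monoid_scheme \<Rightarrow> ('a \<Rightarrow> 'a \<Rightarrow> real) \<Rightarrow> bool" where
  "right_translations_isometric G d \<longleftrightarrow>
     (\<forall>g\<in>carrier G. isometry_of (carrier G) d (\<lambda>x. x \<otimes>\<^bsub>G\<^esub> g))"

text \<open>
  The metric is arbitrary: if the carrier has a standard topology, the metric is
  not required to induce it.  The competing group structures may have any
  multiplication and any neutral element on the same underlying set.
\<close>

definition natural_group :: "('a, 'b) monoid_scheme \<Rightarrow> bool" where
  "natural_group G \<longleftrightarrow>
     group G \<and>
     (\<exists>d. Metric_space (carrier G) d \<and>
          right_translations_isometric G d \<and>
          (\<forall>H :: 'a monoid.
             group H \<and> carrier H = carrier G \<and> right_translations_isometric H d
             \<longrightarrow> H \<cong> G))"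

definition additive_group :: "'a::group_add monoid" where
  "additive_group = \<lparr>carrier = UNIV, monoid.mult = (+), one = 0\<rparr>"

end

theory Submission
  imports Defs
begin

text \<open>
  The metric need not induce the Euclidean topology, so it can be chosen as rigid as possible.
  Since \<open>\<real>\<^sup>n\<close> has the cardinality of the continuum, its vectors can be labelled injectively by
  reals in \<open>[1,2]\<close>. Let the distance of two distinct points be the smaller of the labels of their
  two differences \<open>x - y\<close> and \<open>y - x\<close>. Any symmetric function with values in \<open>[1,2]\<close> off the
  diagonal satisfies the triangle inequality, so this is a translation-invariant metric; and the
  distance determines the difference up to sign.

  An isometry \<open>f\<close> therefore satisfies \<open>f x - f y = \<plusminus>(x - y)\<close> for all \<open>x\<close>, \<open>y\<close>, which leaves only
  translations and point reflections. Point reflections have fixed points, whereas in any group a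
  right translation with a fixed point is the identity. Hence every group structure with isometric
  right translations acts by ordinary translations, so its multiplication is
  \<open>x \<circ> g = x + g - e\<close> with \<open>e\<close> its neutral element, and \<open>g \<mapsto> g - e\<close> is an isomorphism onto the
  additive group.
\<close>

text \<open>
  A point is determined by the members of a countable base that contain it, so the space embeds
  into the power set of the naturals.
\<close>
lemma second_countable_lepoll_real:
  "(UNIV :: 'a::{second_countable_topology,t0_space} set) \<lesssim> (UNIV :: real set)"
proof -
  obtain B :: "'a set set" where B: "countable B" "topological_basis B"
    using ex_countable_basis by blast
  define F where "F x = to_nat_on B ` {U \<in> B. x \<in> U}" for x
  have "inj F"
  proof (rule injI, rule ccontr)
    fix x y :: 'a
    assume eq: "F x = F y" and "x \<noteq> y"
    have "{U \<in> B. x \<in> U} = {U \<in> B. y \<in> U}"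
      using eq inj_on_image_eq_iff[OF inj_on_to_nat_on[OF B(1)]] unfolding F_def by auto
    then have same: "x \<in> U \<longleftrightarrow> y \<in> U" if "U \<in> B" for U
      using that by blast
    obtain V where "open V" "(x \<in> V) \<noteq> (y \<in> V)"
      using \<open>x \<noteq> y\<close> separation_t0[of x y] by blast
    then show False
      using same topological_basisE[OF B(2)] by (metis subsetD)
  qed
  then have "(UNIV :: 'a set) \<lesssim> (UNIV :: nat set set)"
    unfolding lepoll_def by blast
  also have "\<dots> \<approx> (UNIV :: real set)"
    by (rule nat_sets_eqpoll_reals)
  finally show ?thesis .
qed

text \<open>
  If \<open>f\<close> is not a translation, some \<open>x \<noteq> 0\<close> is mapped as by the point reflection
  \<open>x \<mapsto> c - x\<close> with \<open>c = f 0\<close>. That reflection fixes \<open>c / 2\<close>, and \<open>f\<close> must follow it there,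
  since treating one nonzero point as a reflection and another as a translation would break the
  assumption for that pair.
\<close>
lemma translation_or_fixed_point:
  fixes f :: "'a::real_vector \<Rightarrow> 'a"
  assumes f: "\<And>x y. f x - f y = x - y \<or> f x - f y = y - x"
  shows "(\<exists>c. \<forall>x. f x = x + c) \<or> (\<exists>x. f x = x)"
proof (rule ccontr)
  assume contra: "\<not> ?thesis"
  define c where "c = f 0"
  define m where "m = c /\<^sub>R 2"
  have c: "c = m + m"
    unfolding m_def by (simp flip: scaleR_2)
  obtain x where "f x \<noteq> x + c"
    using contra by blast
  then have x: "f x = c - x" "x \<noteq> 0"
    using f[of x 0] by (auto simp: c_def algebra_simps)
  have "m \<noteq> 0"
    using contra c c_def by force
  have m: "f m = m + c"
    using f[of m 0] contra c by (auto simp: c_def[symmetric] algebra_simps)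
  \<comment> \<open>So \<open>f\<close> moves \<open>m\<close> as a translation and \<open>x\<close> as a reflection, giving \<open>m + x = \<plusminus>(m - x)\<close>.\<close>
  have "m + x = m - x \<or> m + x = x - m"
    using f[of m x] unfolding x m by (simp add: algebra_simps)
  then have "x + x = 0 \<or> m + m = 0"
    by (auto simp: algebra_simps)
  then show False
    using \<open>x \<noteq> 0\<close> \<open>m \<noteq> 0\<close> by (simp flip: scaleR_2)
qed

lemma (in group) right_translation_fixed_point_imp_one:
  assumes "x \<in> carrier G" "g \<in> carrier G" "x \<otimes> g = x"
  shows "g = \<one>"
  using assms by simp

text \<open>
  The distance takes values in \<open>{0} \<union> [1,2]\<close>, so the triangle inequality holds because
  \<open>2 \<le> 1 + 1\<close>.
\<close>
lemma Metric_space_of_labels: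
  fixes J :: "'a::group_add \<Rightarrow> real"
  assumes J: "\<And>v. 1 \<le> J v" "\<And>v. J v \<le> 2"
  shows "Metric_space UNIV (\<lambda>x y. if x = y then 0 else min (J (x - y)) (J (y - x)))"
proof
  fix x y z :: 'a
  show "(if x = z then 0 else min (J (x - z)) (J (z - x)))
      \<le> (if x = y then 0 else min (J (x - y)) (J (y - x)))
        + (if y = z then 0 else min (J (y - z)) (J (z - y)))"
    using J[of "x - z"] J[of "x - y"] J[of "y - x"] J[of "y - z"] J[of "z - y"]
    by (auto simp: min_def)
next
  fix x y :: 'a
  show "((if x = y then 0 else min (J (x - y)) (J (y - x))) = 0) = (x = y)"
    using J(1)[of "x - y"] J(1)[of "y - x"] by (auto simp: min_def)
  show "0 \<le> (if x = y then 0 else min (J (x - y)) (J (y - x)))"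
    using J(1)[of "x - y"] J(1)[of "y - x"] by auto
qed (auto simp: min.commute)

text \<open>
  The minimum of two labels is the label of one of the two differences, so equal distances force
  equal or opposite differences.
\<close>
lemma equal_label_distance_imp_difference_up_to_sign:
  fixes J :: "'a::ab_group_add \<Rightarrow> real"
  assumes "inj J"
    and "min (J (a - b)) (J (b - a)) = min (J (x - y)) (J (y - x))"
  shows "a - b = x - y \<or> a - b = y - x"
proof -
  have "J (a - b) = J (x - y) \<or> J (a - b) = J (y - x) \<or>
        J (b - a) = J (x - y) \<or> J (b - a) = J (y - x)"
    using assms(2) by (auto simp: min_def split: if_splits)
  then have "a - b = x - y \<or> a - b = y - x \<or> b - a = x - y \<or> b - a = y - x"
    using \<open>inj J\<close> by (simp add: inj_eq)
  then show ?thesis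
    by (metis minus_diff_eq)
qed

text \<open>
  Evaluating the translation \<open>x \<mapsto> x \<otimes> g\<close> at the neutral element identifies its translation
  vector as \<open>g - \<one>\<close>.
\<close>
lemma iso_additive_group_if_acts_by_translations:
  fixes H :: "'a::ab_group_add monoid"
  assumes "group H" and carrier: "carrier H = UNIV"
    and trans: "\<And>g. \<exists>c. \<forall>x. x \<otimes>\<^bsub>H\<^esub> g = x + c"
  shows "H \<cong> (additive_group :: 'a monoid)"
proof -
  interpret H: group H by fact
  have mult: "x \<otimes>\<^bsub>H\<^esub> g = x + (g - \<one>\<^bsub>H\<^esub>)" for x g
  proof -
    obtain c where c: "\<And>x. x \<otimes>\<^bsub>H\<^esub> g = x + c"
      using trans by blast
    have "g = \<one>\<^bsub>H\<^esub> + c"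
      using c[of "\<one>\<^bsub>H\<^esub>"] H.l_one[of g] carrier by simp
    then show ?thesis
      using c by simp
  qed
  have "(\<lambda>g. g - \<one>\<^bsub>H\<^esub>) \<in> iso H additive_group"
  proof (rule isoI)
    show "(\<lambda>g. g - \<one>\<^bsub>H\<^esub>) \<in> hom H additive_group"
      by (auto simp: hom_def additive_group_def mult)
    show "bij_betw (\<lambda>g. g - \<one>\<^bsub>H\<^esub>) (carrier H) (carrier additive_group)"
      unfolding carrier additive_group_def
      by (auto intro: bij_betw_byWitness[where f' = "\<lambda>x. x + \<one>\<^bsub>H\<^esub>"])
  qed
  then show ?thesis
    by (rule is_isoI)
qed

lemma group_additive_group: "group (additive_group :: 'a::group_add monoid)"
  unfolding additive_group_def
  by (rule groupI) (auto simp: add.assoc intro: left_minus)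

theorem natural_group_real_vector:
  assumes card: "(UNIV :: 'a::real_vector set) \<lesssim> (UNIV :: real set)"
  shows "natural_group (additive_group :: 'a monoid)"
proof -
  have "(UNIV :: real set) \<approx> {1..2::real}"
    by (simp add: closed_interval_eqpoll_reals eqpoll_sym)
  with card have "(UNIV :: 'a set) \<lesssim> {1..2::real}"
    by (rule lepoll_trans2)
  then obtain J :: "'a \<Rightarrow> real" where "inj J" and J: "1 \<le> J v" "J v \<le> 2" for v
    unfolding lepoll_def by (auto simp: image_subset_iff)
  define d where "d = (\<lambda>x y. if x = y then 0 else min (J (x - y)) (J (y - x)))"
  have metric: "Metric_space UNIV d"
    unfolding d_def by (rule Metric_space_of_labels[OF J])
  have invariant: "right_translations_isometric (additive_group :: 'a monoid) d"
    unfolding right_translations_isometric_def isometry_of_def additive_group_def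
    by (auto simp: d_def intro: bij_betw_byWitness[where f' = "\<lambda>x. x - g" for g])
  have iso: "H \<cong> (additive_group :: 'a monoid)"
    if "group H" and carrier: "carrier H = UNIV" and isom: "right_translations_isometric H d"
    for H :: "'a monoid"
  proof (rule iso_additive_group_if_acts_by_translations[OF \<open>group H\<close> carrier])
    interpret H: group H by fact
    fix g
    let ?R = "\<lambda>x. x \<otimes>\<^bsub>H\<^esub> g"
    have R: "bij ?R" "d (?R x) (?R y) = d x y" for x y
      using isom carrier by (auto simp: right_translations_isometric_def isometry_of_def)
    have "?R x - ?R y = x - y \<or> ?R x - ?R y = y - x" for x y
    proof (cases "x = y")
      case False
      then have "?R x \<noteq> ?R y"
        using R(1) by (auto dest: bij_is_inj injD)
      with False R(2)[of x y] show ?thesis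
        by (intro equal_label_distance_imp_difference_up_to_sign[OF \<open>inj J\<close>]) (simp add: d_def)
    qed simp
    then consider c where "\<forall>x. ?R x = x + c" | x where "?R x = x"
      using translation_or_fixed_point[of ?R] by blast
    then show "\<exists>c. \<forall>x. ?R x = x + c"
    proof cases
      case (2 x)
      then have "g = \<one>\<^bsub>H\<^esub>"
        using H.right_translation_fixed_point_imp_one carrier by blast
      then show ?thesis
        using H.r_one carrier by (intro exI[of _ 0]) simp
    qed blast
  qed
  have "carrier (additive_group :: 'a monoid) = UNIV"
    by (simp add: additive_group_def)
  then show ?thesis
    unfolding natural_group_def using group_additive_group metric invariant iso by auto
qed

theorem theorem8:
  shows "natural_group (additive_group :: (real ^ 'n::finite) monoid)"
  by (rule natural_group_real_vector[OF second_countable_lepoll_real])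

end
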